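(* Let $(\mathscr A,\preceq,\multimap,!)$ be an exponential implicative structure. Define $a\to b := {!a}\multimap b$. Then $(\mathscr A,\preceq,\to)$ is an implicative structure. Moreover, if $S\subseteq\mathscr A$ is an exponential separator of $(\mathscr A,\preceq,\multimap,!)$, then $S$ is an intuitionistic separator of $(\mathscr A,\preceq,\to)$: it is upward closed, closed under modus ponens for $\to$ (i.e. $a\in S$ and $({!a}\multimap b)\in S$ imply $b\in S$), and contains $\mathbf K'=\bigwedge_{a,b}({!a}\multimap{!b}\multimap a)$ and $\mathbf S'=\bigwedge_{a,b,c}({!({!a}\multimap{!b}\multimap c)}\multimap{!({!a}\multimap b)}\multimap{!a}\multimap c)$.
   Context: An implicative structure $(\mathscr A,\preceq,\multimap)$ is a complete lattice with a binary operation $\multimap$ such that $a'\preceq a$, $b\preceq b'$ imply $(a\multimap b)\preceq(a'\multimap b')$, and $a\multimap\bigwedge_{b\in B}b=\bigwedge_{b\in B}(a\multimap b)$ for all $B\subseteq\mathscr A$; $\multimap$ associates to the right. An exponential implicative structure is an implicative structure together with a monotone map $!:\mathscr A\to\mathscr A$. A linear separator is a subset $S$ that is upward closed, closed under modus ponens ($a\in S$, $(a\multimap b)\in S$ imply $b\in S$), and contains $\bigwedge_a(a\multimap a)$, $\bigwedge_{a,b,c}((b\multimap c)\multimap(a\multimap b)\multimap a\multimap c)$ and $\bigwedge_{a,b,c}((a\multimap b\multimap c)\multimap b\multimap a\multimap c)$. An exponential separator is a linear separator $S$ closed under $!$ ($a\in S\Rightarrow {!a}\in S$) and containing $\mathbf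 K_!=\bigwedge_{a,b}(a\multimap{!b}\multimap a)$, $\mathbf W_!=\bigwedge_{a,b}(({!a}\multimap{!a}\multimap b)\multimap{!a}\multimap b)$, $\mathbf F=\bigwedge_{a,b}({!(a\multimap b)}\multimap{!a}\multimap{!b})$, $\mathbf D=\bigwedge_a({!a}\multimap a)$ and $\delta=\bigwedge_a({!a}\multimap{!!a})$. *)

theory Defs
  imports Main
begin

locale implicative_structure =
  fixes imp :: "'a::complete_lattice \<Rightarrow> 'a \<Rightarrow> 'a"  (infixr "\<multimap>" 60)
  assumes imp_mono: "\<And>a a' b b'. a' \<le> a \<Longrightarrow> b \<le> b' \<Longrightarrow> (a \<multimap> b) \<le> (a' \<multimap> b')"
    and imp_Inf: "\<And>a B. (a \<multimap> Inf B) = (INF b\<in>B. a \<multimap> b)"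

locale exponential_implicative_structure = implicative_structure imp
  for imp :: "'a::complete_lattice \<Rightarrow> 'a \<Rightarrow> 'a"  (infixr "\<multimap>" 60) +
  fixes bang :: "'a \<Rightarrow> 'a"
  assumes bang_mono: "mono bang"

locale linear_separator = implicative_structure imp
  for imp :: "'a::complete_lattice \<Rightarrow> 'a \<Rightarrow> 'a"  (infixr "\<multimap>" 60) +
  fixes S :: "'a set"
  assumes upward_closed: "\<And>a b. a \<in> S \<Longrightarrow> a \<le> b \<Longrightarrow> b \<in> S"
    and modus_ponens: "\<And>a b. a \<in> S \<Longrightarrow> (a \<multimap> b) \<in> S \<Longrightarrow> b \<in> S"
    and I_in: "(INF a. a \<multimap> a) \<in> S"
    and B_in: "(INF a b c. (b \<multimap> c) \<multimap> (a \<multimap> b) \<multimap> a \<multimap> c) \<in> S"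
    and C_in: "(INF a b c. (a \<multimap> b \<multimap> c) \<multimap> b \<multimap> a \<multimap> c) \<in> S"

locale exponential_separator =
  exponential_implicative_structure imp bang + linear_separator imp S
  for imp :: "'a::complete_lattice \<Rightarrow> 'a \<Rightarrow> 'a"  (infixr "\<multimap>" 60)
    and bang :: "'a \<Rightarrow> 'a"
    and S :: "'a set" +
  assumes bang_closed: "\<And>a. a \<in> S \<Longrightarrow> bang a \<in> S"
    and K_bang_in: "(INF a b. a \<multimap> bang b \<multimap> a) \<in> S"
    and W_bang_in: "(INF a b. (bang a \<multimap> bang a \<multimap> b) \<multimap> bang a \<multimap> b) \<in> S"
    and F_in: "(INF a b. bang (a \<multimap> b) \<multimap> bang a \<multimap> bang b) \<in> S"
    and D_in: "(INF a. bang a \<multimap> a) \<in> S"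
    and delta_in: "(INF a. bang a \<multimap> bang (bang a)) \<in> S"

locale intuitionistic_separator = implicative_structure imp
  for imp :: "'a::complete_lattice \<Rightarrow> 'a \<Rightarrow> 'a"  (infixr "\<leadsto>" 60) +
  fixes S :: "'a set"
  assumes upward_closed: "\<And>a b. a \<in> S \<Longrightarrow> a \<le> b \<Longrightarrow> b \<in> S"
    and modus_ponens: "\<And>a b. a \<in> S \<Longrightarrow> (a \<leadsto> b) \<in> S \<Longrightarrow> b \<in> S"
    and K_in: "(INF a b. a \<leadsto> b \<leadsto> a) \<in> S"
    and S_in: "(INF a b c. (a \<leadsto> b \<leadsto> c) \<leadsto> (a \<leadsto> b) \<leadsto> a \<leadsto> c) \<in> S"

definition bang_imp :: "('a \<Rightarrow> 'a \<Rightarrow> 'a) \<Rightarrow> ('a \<Rightarrow> 'a) \<Rightarrow> 'a \<Rightarrow> 'a \<Rightarrow> 'a"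
  where "bang_imp imp bang a b = imp (bang a) b"

end

theory Submission
  imports Defs "HOL-Library.Liminf_Limsup"
begin

text \<open>
  For a separator \<open>S\<close> and an index type \<open>'i\<close>, the families \<open>f :: 'i \<Rightarrow> 'a\<close> with \<open>(INF i. f i) \<in> S\<close>
  again form a separator, in the pointwise structure on \<open>'i \<Rightarrow> 'a\<close>. A combinator schema derived for
  arbitrary elements of an arbitrary separator therefore holds for the coordinate projections
  in \<open>'a \<times> 'a \<Rightarrow> 'a\<close>, which says that its infimum over all elements lies in \<open>S\<close>.

  It remains to derive the two schemas. \<open>\<^bold>K'\<close> is \<open>\<^bold>D\<close> followed by \<open>\<^bold>K\<^sub>!\<close>. For \<open>\<^bold>S'\<close>,
  \<open>\<^bold>F\<close> and \<open>\<delta>\<close> turn \<open>!(!a \<multimap> b)\<close> into \<open>!a \<multimap> !b\<close>; composing with \<open>!b \<multimap> !a \<multimap> c\<close> gives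
  \<open>!a \<multimap> !a \<multimap> c\<close>, and \<open>\<^bold>W\<^sub>!\<close> contracts the two copies of \<open>!a\<close>.
\<close>

definition (in implicative_structure) pointwise_imp ::
    "('i \<Rightarrow> 'a) \<Rightarrow> ('i \<Rightarrow> 'a) \<Rightarrow> 'i \<Rightarrow> 'a"  (infixr "\<multimap>\<^sub>p" 60)
  where "(f \<multimap>\<^sub>p g) = (\<lambda>i. f i \<multimap> g i)"

definition uniform_separator :: "'a::complete_lattice set \<Rightarrow> ('i \<Rightarrow> 'a) set"
  where "uniform_separator S = {f. (INF i. f i) \<in> S}"

lemma mem_uniform_separator_iff: "f \<in> uniform_separator S \<longleftrightarrow> (INF i. f i) \<in> S"
  by (simp add: uniform_separator_def)

lemma (in implicative_structure) implicative_structure_pointwise_imp: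
  "implicative_structure (\<multimap>\<^sub>p)"
proof
  show "(f \<multimap>\<^sub>p g) \<le> (f' \<multimap>\<^sub>p g')" if "f' \<le> f" "g \<le> g'" for f f' g g'
    using that by (simp add: pointwise_imp_def le_fun_def imp_mono)
  show "(f \<multimap>\<^sub>p Inf G) = (INF g\<in>G. f \<multimap>\<^sub>p g)" for f G
    by (simp add: pointwise_imp_def fun_eq_iff imp_Inf image_image)
qed

lemma (in exponential_implicative_structure) exponential_implicative_structure_pointwise_imp:
  "exponential_implicative_structure (\<multimap>\<^sub>p) ((\<circ>) bang)"
proof (intro exponential_implicative_structure.intro implicative_structure_pointwise_imp)
  show "exponential_implicative_structure_axioms ((\<circ>) bang)"
    by standard (simp add: mono_def le_fun_def monoD[OF bang_mono])
qed

context linear_separator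
begin

lemma INF_modus_ponens:
  assumes "(INF i. f i) \<in> S" "(INF i. f i \<multimap> g i) \<in> S"
  shows "(INF i. g i) \<in> S"
proof (rule modus_ponens[OF assms(1)])
  have "(INF i. f i \<multimap> g i) \<le> (INF i. (INF j. f j) \<multimap> g i)"
    by (intro INF_mono' imp_mono INF_lower order_refl UNIV_I)
  also have "\<dots> = ((INF i. f i) \<multimap> (INF i. g i))"
    by (simp add: imp_Inf image_image)
  finally show "((INF i. f i) \<multimap> (INF i. g i)) \<in> S"
    using assms(2) upward_closed by blast
qed

lemma uniform_separatorI:
  assumes "a \<in> S" "\<And>i. a \<le> f i"
  shows "f \<in> uniform_separator S"
  unfolding mem_uniform_separator_iff
  using assms(1) by (rule upward_closed) (intro INF_greatest assms(2))

lemma linear_separator_uniform_separator: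
  "linear_separator (\<multimap>\<^sub>p) (uniform_separator S)"
proof (intro linear_separator.intro implicative_structure_pointwise_imp)
  show "linear_separator_axioms (\<multimap>\<^sub>p) (uniform_separator S)"
  proof
    show "g \<in> uniform_separator S" if "f \<in> uniform_separator S" "f \<le> g" for f g
      using that upward_closed INF_mono'
      unfolding mem_uniform_separator_iff le_fun_def by metis
    show "g \<in> uniform_separator S"
      if "f \<in> uniform_separator S" "(f \<multimap>\<^sub>p g) \<in> uniform_separator S" for f g
      using that INF_modus_ponens unfolding mem_uniform_separator_iff pointwise_imp_def by blast
    show "(INF f. f \<multimap>\<^sub>p f) \<in> uniform_separator S"
      by (rule uniform_separatorI[OF I_in])
        (force simp: pointwise_imp_def image_image intro!: INF_greatest intro: INF_lower2)
    show "(INF f g h. (g \<multimap>\<^sub>p h) \<multimap>\<^sub>p (f \<multimap>\<^sub>p g) \<multimap>\<^sub>p f \<multimap>\<^sub>p h) \<in> uniform_separator S"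
      by (rule uniform_separatorI[OF B_in])
        (force simp: pointwise_imp_def image_image intro!: INF_greatest intro: INF_lower2)
    show "(INF f g h. (f \<multimap>\<^sub>p g \<multimap>\<^sub>p h) \<multimap>\<^sub>p g \<multimap>\<^sub>p f \<multimap>\<^sub>p h) \<in> uniform_separator S"
      by (rule uniform_separatorI[OF C_in])
        (force simp: pointwise_imp_def image_image intro!: INF_greatest intro: INF_lower2)
  qed
qed

lemma imp_comp: "((b \<multimap> c) \<multimap> (a \<multimap> b) \<multimap> a \<multimap> c) \<in> S"
  by (rule upward_closed[OF B_in]) (auto intro: INF_lower2)

lemma imp_swap: "((a \<multimap> b \<multimap> c) \<multimap> b \<multimap> a \<multimap> c) \<in> S"
  by (rule upward_closed[OF C_in]) (auto intro: INF_lower2)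

lemma imp_postcomp: "(b \<multimap> c) \<in> S \<Longrightarrow> ((a \<multimap> b) \<multimap> a \<multimap> c) \<in> S"
  by (rule modus_ponens[OF _ imp_comp])

lemma imp_precomp: "(a \<multimap> b) \<in> S \<Longrightarrow> ((b \<multimap> c) \<multimap> a \<multimap> c) \<in> S"
  by (rule modus_ponens[OF _ modus_ponens[OF imp_comp imp_swap]])

lemma imp_trans: "(a \<multimap> b) \<in> S \<Longrightarrow> (b \<multimap> c) \<in> S \<Longrightarrow> (a \<multimap> c) \<in> S"
  by (rule modus_ponens[OF _ imp_postcomp])

end

context exponential_separator
begin

lemma exponential_separator_uniform_separator:
  "exponential_separator (\<multimap>\<^sub>p) ((\<circ>) bang) (uniform_separator S)"
proof (intro exponential_separator.intro exponential_implicative_structure_pointwise_imp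
    linear_separator_uniform_separator)
  show "exponential_separator_axioms (\<multimap>\<^sub>p) ((\<circ>) bang) (uniform_separator S)"
  proof
    show "bang \<circ> f \<in> uniform_separator S" if "f \<in> uniform_separator S" for f
    proof (rule uniform_separatorI)
      show "bang (INF i. f i) \<in> S"
        using that by (simp add: mem_uniform_separator_iff bang_closed)
      show "bang (INF i. f i) \<le> (bang \<circ> f) i" for i
        by (auto intro!: monoD[OF bang_mono] INF_lower)
    qed
    show "(INF f g. f \<multimap>\<^sub>p (bang \<circ> g) \<multimap>\<^sub>p f) \<in> uniform_separator S"
      by (rule uniform_separatorI[OF K_bang_in])
        (force simp: pointwise_imp_def image_image intro!: INF_greatest intro: INF_lower2)
    show "(INF f g. ((bang \<circ> f) \<multimap>\<^sub>p (bang \<circ> f) \<multimap>\<^sub>p g) \<multimap>\<^sub>p (bang \<circ> f) \<multimap>\<^sub>p g) \<in> uniform_separator S"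
      by (rule uniform_separatorI[OF W_bang_in])
        (force simp: pointwise_imp_def image_image intro!: INF_greatest intro: INF_lower2)
    show "(INF f g. (bang \<circ> (f \<multimap>\<^sub>p g)) \<multimap>\<^sub>p (bang \<circ> f) \<multimap>\<^sub>p (bang \<circ> g)) \<in> uniform_separator S"
      by (rule uniform_separatorI[OF F_in])
        (force simp: pointwise_imp_def image_image intro!: INF_greatest intro: INF_lower2)
    show "(INF f. (bang \<circ> f) \<multimap>\<^sub>p f) \<in> uniform_separator S"
      by (rule uniform_separatorI[OF D_in])
        (force simp: pointwise_imp_def image_image intro!: INF_greatest intro: INF_lower2)
    show "(INF f. (bang \<circ> f) \<multimap>\<^sub>p (bang \<circ> (bang \<circ> f))) \<in> uniform_separator S"
      by (rule uniform_separatorI[OF delta_in])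
        (force simp: pointwise_imp_def image_image intro!: INF_greatest intro: INF_lower2)
  qed
qed

lemma bang_weakening: "(a \<multimap> bang b \<multimap> a) \<in> S"
  by (rule upward_closed[OF K_bang_in]) (auto intro: INF_lower2)

lemma bang_contraction: "((bang a \<multimap> bang a \<multimap> b) \<multimap> bang a \<multimap> b) \<in> S"
  by (rule upward_closed[OF W_bang_in]) (auto intro: INF_lower2)

lemma bang_functoriality: "(bang (a \<multimap> b) \<multimap> bang a \<multimap> bang b) \<in> S"
  by (rule upward_closed[OF F_in]) (auto intro: INF_lower2)

lemma bang_dereliction: "(bang a \<multimap> a) \<in> S"
  by (rule upward_closed[OF D_in]) (auto intro: INF_lower2)

lemma bang_digging: "(bang a \<multimap> bang (bang a)) \<in> S"
  by (rule upward_closed[OF delta_in]) (auto intro: INF_lower2)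

lemma bang_promotion: "(bang (bang a \<multimap> b) \<multimap> bang a \<multimap> bang b) \<in> S"
  by (rule imp_trans[OF bang_functoriality imp_precomp[OF bang_digging]])

lemma bang_imp_K: "(bang a \<multimap> bang b \<multimap> a) \<in> S"
  by (rule imp_trans[OF bang_dereliction bang_weakening])

lemma bang_imp_S:
  "(bang (bang a \<multimap> bang b \<multimap> c) \<multimap> bang (bang a \<multimap> b) \<multimap> bang a \<multimap> c) \<in> S"
proof -
  let ?P = "bang (bang a \<multimap> bang b \<multimap> c)"
  have "(?P \<multimap> bang b \<multimap> bang a \<multimap> c) \<in> S"
    by (rule imp_trans[OF bang_dereliction imp_swap])
  then have "(?P \<multimap> (bang a \<multimap> bang b) \<multimap> bang a \<multimap> bang a \<multimap> c) \<in> S"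
    by (rule imp_trans[OF _ imp_comp])
  then have "(?P \<multimap> (bang a \<multimap> bang b) \<multimap> bang a \<multimap> c) \<in> S"
    by (rule imp_trans[OF _ imp_postcomp[OF bang_contraction]])
  then show ?thesis
    by (rule imp_trans[OF _ imp_precomp[OF bang_promotion]])
qed

lemma INF_bang_imp_K: "(INF a b. bang a \<multimap> bang b \<multimap> a) \<in> S"
proof -
  have "(INF p. bang (fst p) \<multimap> bang (snd p) \<multimap> fst p) \<in> S"
    using exponential_separator.bang_imp_K[OF exponential_separator_uniform_separator, of fst snd]
    by (simp add: mem_uniform_separator_iff pointwise_imp_def)
  then show ?thesis
    by (simp add: INF_pair case_prod_unfold)
qed

lemma INF_bang_imp_S:
  "(INF a b c. bang (bang a \<multimap> bang b \<multimap> c) \<multimap> bang (bang a \<multimap> b) \<multimap> bang a \<multimap> c) \<in> S"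
proof -
  have "(INF (a, b, c). bang (bang a \<multimap> bang b \<multimap> c) \<multimap> bang (bang a \<multimap> b) \<multimap> bang a \<multimap> c) \<in> S"
    using exponential_separator.bang_imp_S[OF exponential_separator_uniform_separator,
        of fst "fst \<circ> snd" "snd \<circ> snd"]
    by (simp add: mem_uniform_separator_iff pointwise_imp_def case_prod_unfold)
  then show ?thesis
    by (simp add: INF_pair case_prod_unfold)
qed

end

lemma (in exponential_implicative_structure) implicative_structure_bang_imp:
  "implicative_structure (bang_imp imp bang)"
proof
  show "bang_imp imp bang a b \<le> bang_imp imp bang a' b'" if "a' \<le> a" "b \<le> b'" for a a' b b'
    unfolding bang_imp_def using that by (intro imp_mono monoD[OF bang_mono])
  show "bang_imp imp bang a (Inf B) = (INF b\<in>B. bang_imp imp bang a b)" for a B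
    unfolding bang_imp_def by (rule imp_Inf)
qed

lemma (in exponential_separator) intuitionistic_separator_bang_imp:
  "intuitionistic_separator (bang_imp imp bang) S"
proof (intro intuitionistic_separator.intro implicative_structure_bang_imp)
  show "intuitionistic_separator_axioms (bang_imp imp bang) S"
  proof
    show "b \<in> S" if "a \<in> S" "a \<le> b" for a b
      using that by (rule upward_closed)
    show "b \<in> S" if "a \<in> S" "bang_imp imp bang a b \<in> S" for a b
      using that modus_ponens bang_closed unfolding bang_imp_def by blast
  qed (simp_all only: bang_imp_def INF_bang_imp_K INF_bang_imp_S)
qed

theorem theorem4p1:
  fixes imp :: "'a::complete_lattice \<Rightarrow> 'a \<Rightarrow> 'a"  (infixr "\<multimap>" 60)
    and bang :: "'a \<Rightarrow> 'a"
  assumes "exponential_implicative_structure (\<multimap>) bang"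
  shows "implicative_structure (bang_imp (\<multimap>) bang) \<and>
    (\<forall>S. exponential_separator (\<multimap>) bang S \<longrightarrow>
      intuitionistic_separator (bang_imp (\<multimap>) bang) S \<and>
      (\<forall>a b. a \<in> S \<longrightarrow> a \<le> b \<longrightarrow> b \<in> S) \<and>
      (\<forall>a b. a \<in> S \<longrightarrow> (bang a \<multimap> b) \<in> S \<longrightarrow> b \<in> S) \<and>
      (INF a b. bang a \<multimap> bang b \<multimap> a) \<in> S \<and>
      (INF a b c. bang (bang a \<multimap> bang b \<multimap> c) \<multimap> bang (bang a \<multimap> b) \<multimap> bang a \<multimap> c) \<in> S)"
proof (intro conjI allI impI)
  show "implicative_structure (bang_imp (\<multimap>) bang)"
    using assms by (rule exponential_implicative_structure.implicative_structure_bang_imp)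
next
  fix S
  assume "exponential_separator (\<multimap>) bang S"
  then show "intuitionistic_separator (bang_imp (\<multimap>) bang) S"
    by (rule exponential_separator.intuitionistic_separator_bang_imp)
  then interpret intuitionistic_separator "bang_imp (\<multimap>) bang" S .
  show "b \<in> S" if "a \<in> S" "a \<le> b" for a b
    using that by (rule upward_closed)
  show "b \<in> S" if "a \<in> S" "(bang a \<multimap> b) \<in> S" for a b
    using that by (rule modus_ponens[unfolded bang_imp_def])
  show "(INF a b. bang a \<multimap> bang b \<multimap> a) \<in> S"
    by (rule K_in[unfolded bang_imp_def])
  show "(INF a b c. bang (bang a \<multimap> bang b \<multimap> c) \<multimap> bang (bang a \<multimap> b) \<multimap> bang a \<multimap> c) \<in> S"
    by (rule S_in[unfolded bang_imp_def])
qed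

end
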